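(* Let $p\geq 3$ be a prime and let $n\geq 1$ be an integer. Let $K\subseteq \mathbb{F}_p$ be a fixed subset with $0\in K$, and set $t:=|K|$. Suppose that $A\subseteq (\mathbb{F}_p)^n$ is a subset such that $|A|> (p-t+1)^n$. Then there exist $\mathbf{a}_1,\mathbf{a}_2\in A$ with $\mathbf{a}_1\neq \mathbf{a}_2$ such that $\mathbf{a}_1-\mathbf{a}_2\in K^n$.
   Context: $\mathbb{F}_p$ denotes the field with $p$ elements, and $K^n=\{(k_1,\ldots,k_n): k_i\in K \text{ for all } i\}\subseteq (\mathbb{F}_p)^n$. *)

theory Defs
  imports
    "HOL-Analysis.Finite_Cartesian_Product"
    "Berlekamp_Zassenhaus.Finite_Field"
begin

text \<open>
  The field with \<open>p\<close> elements is the type \<open>'p mod_ring\<close> (integers modulo \<open>CARD('p)\<close>),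
  where the class \<open>prime_card\<close> says that \<open>CARD('p)\<close> is prime; \<open>(F\<^sub>p)\<^sup>n\<close>
  is \<open>'p mod_ring ^ 'n\<close> with \<open>n = CARD('n)\<close>. The index type \<open>'n\<close> is determined by the
  ambient vector type.
\<close>

definition cart_power :: "'a set \<Rightarrow> ('a ^ 'n::finite) set" where
  "cart_power K = {x. \<forall>i. x $ i \<in> K}"

end

theory Submission
  imports Defs
begin

text \<open>
  The product over all coordinates \<open>i\<close> of \<open>\<Prod>k\<notin>K. (x\<^sub>i - a\<^sub>i - k)\<close> is a polynomial in \<open>x\<close> of
  degree at most \<open>p - t\<close> in each variable that is non-zero exactly where \<open>x - a\<close> lies in
  \<open>K\<^sup>n\<close>. If no difference of distinct elements of \<open>A\<close> lies in \<open>K\<^sup>n\<close>, these polynomials are,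
  up to scaling, the point indicators on \<open>A\<close>, so every function on \<open>A\<close> is a linear
  combination of the \<open>(p - t + 1)\<^sup>n\<close> monomials of bounded degree. Since the field is finite,
  counting functions against coefficient vectors replaces the comparison of dimensions.
\<close>

text \<open>Composing with a linear polynomial does not raise the degree. Padding with zero
  coefficients up to \<open>d\<close> gives an exponent range that does not depend on
  \<open>a\<close>.\<close>

lemma poly_shift_eq_sum:
  fixes P :: "'a::comm_ring_1 poly"
  assumes "degree P \<le> d"
  shows "poly P (x - a) = (\<Sum>j\<le>d. coeff (pcompose P [:- a, 1:]) j * x ^ j)"
proof -
  have "degree (pcompose P [:- a, 1:]) \<le> degree P * degree [:- a, 1:]"
    by (rule degree_pcompose_le)
  also have "\<dots> \<le> d"
    using assms by simp
  finally have "degree (pcompose P [:- a, 1:]) \<le> d" .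
  then have "poly (pcompose P [:- a, 1:]) x = (\<Sum>j\<le>d. coeff (pcompose P [:- a, 1:]) j * x ^ j)"
    unfolding poly_altdef by (intro sum.mono_neutral_left) (auto simp: coeff_eq_0)
  then show ?thesis
    by (simp add: poly_pcompose)
qed

lemma card_le_monomials_if_separating_poly:
  fixes A :: "('a::{field,finite} ^ 'n::finite) set"
  assumes deg: "degree P \<le> d"
    and P0: "poly P 0 \<noteq> 0"
    and sep: "\<And>a b. a \<in> A \<Longrightarrow> b \<in> A \<Longrightarrow> a \<noteq> b \<Longrightarrow> \<exists>i. poly P (b $ i - a $ i) = 0"
  shows "card A \<le> (d + 1) ^ CARD('n)"
proof -
  define E where "E = (\<Pi>\<^sub>E i\<in>(UNIV :: 'n set). {..d})"
  define f where "f a x = (\<Prod>i\<in>UNIV. poly P (x $ i - a $ i))" for a x :: "'a ^ 'n"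
  define C where "C a e = (\<Prod>i\<in>UNIV. coeff (pcompose P [:- (a $ i), 1:]) (e i))"
    for a :: "'a ^ 'n" and e :: "'n \<Rightarrow> nat"
  \<comment> \<open>Restricting to \<open>A\<close> makes \<open>ev c\<close> extensional, so it can
    equal a member of \<open>A \<rightarrow>\<^sub>E UNIV\<close> as a function.\<close>
  define ev where "ev c = (\<lambda>x\<in>A. \<Sum>e\<in>E. c e * (\<Prod>i\<in>UNIV. x $ i ^ e i))" for c
  have finA: "finite A"
    by (rule finite)
  have finE: "finite E"
    unfolding E_def by (intro finite_PiE) auto
  have f_expand: "f a x = (\<Sum>e\<in>E. C a e * (\<Prod>i\<in>UNIV. x $ i ^ e i))" for a x
  proof -
    have "f a x = (\<Prod>i\<in>UNIV. \<Sum>j\<le>d. coeff (pcompose P [:- (a $ i), 1:]) j * x $ i ^ j)"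
      unfolding f_def using poly_shift_eq_sum[OF deg] by simp
    also have "\<dots> = (\<Sum>e\<in>E. \<Prod>i\<in>UNIV. coeff (pcompose P [:- (a $ i), 1:]) (e i) * x $ i ^ e i)"
      unfolding E_def by (rule prod_sum_PiE) auto
    finally show ?thesis
      by (simp add: C_def prod.distrib)
  qed
  have f_diag: "f a a \<noteq> 0" for a
    using P0 by (simp add: f_def)
  have f_off: "f a b = 0" if "a \<in> A" "b \<in> A" "a \<noteq> b" for a b
    using sep[OF that] by (auto simp: f_def)
  have "(A \<rightarrow>\<^sub>E (UNIV :: 'a set)) \<subseteq> ev ` (E \<rightarrow>\<^sub>E UNIV)"
  proof
    fix g :: "'a ^ 'n \<Rightarrow> 'a" assume g: "g \<in> A \<rightarrow>\<^sub>E UNIV"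
    \<comment> \<open>Lagrange interpolation: these are the coefficients of the sum of
      \<open>g a / f a a * f a x\<close> over \<open>a\<close> in \<open>A\<close>.\<close>
    define c where "c = (\<lambda>e\<in>E. \<Sum>a\<in>A. g a / f a a * C a e)"
    have "ev c x = g x" if x: "x \<in> A" for x
    proof -
      have "ev c x = (\<Sum>e\<in>E. \<Sum>a\<in>A. g a / f a a * (C a e * (\<Prod>i\<in>UNIV. x $ i ^ e i)))"
        using x by (simp add: ev_def c_def sum_distrib_right mult.assoc)
      also have "\<dots> = (\<Sum>a\<in>A. g a / f a a * f a x)"
        by (subst sum.swap) (simp only: f_expand[of _ x] sum_distrib_left)
      also have "\<dots> = (\<Sum>a\<in>A. if a = x then g x else 0)"
        using f_diag f_off x by (intro sum.cong) auto
      finally show ?thesis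
        using x finA by simp
    qed
    moreover have "ev c x = g x" if "x \<notin> A" for x
      using that g by (auto simp: ev_def PiE_def extensional_def)
    ultimately have "g x = ev c x" for x
      by (cases "x \<in> A") simp_all
    then have "g = ev c"
      by (rule ext)
    moreover have "c \<in> E \<rightarrow>\<^sub>E UNIV"
      by (simp add: c_def)
    ultimately show "g \<in> ev ` (E \<rightarrow>\<^sub>E UNIV)"
      by blast
  qed
  then have "card (A \<rightarrow>\<^sub>E (UNIV :: 'a set)) \<le> card (E \<rightarrow>\<^sub>E (UNIV :: 'a set))"
    using finE by (intro surj_card_le finite_PiE) auto
  then have "CARD('a) ^ card A \<le> CARD('a) ^ card E"
    using finA finE by (simp add: card_funcsetE)
  \<comment> \<open>A base above 1 lets the exponents be compared.\<close>
  moreover have "CARD('a) > 1"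
    using card_mono[of UNIV "{0, 1 :: 'a}"] by simp
  ultimately have "card A \<le> card E"
    by (simp add: power_increasing_iff)
  also have "card E = (d + 1) ^ CARD('n)"
    by (simp add: E_def card_funcsetE)
  finally show ?thesis .
qed

theorem theorem1p2:
  fixes p n t :: nat
    and K :: "'p::prime_card mod_ring set"
    and A :: "('p mod_ring ^ 'n::finite) set"
  assumes "p = CARD('p)" and "p \<ge> 3"
    and "n = CARD('n)" and "n \<ge> 1"
    and "0 \<in> K" and "t = card K"
    and "card A > (p - t + 1) ^ n"
  shows "\<exists>a\<^sub>1\<in>A. \<exists>a\<^sub>2\<in>A. a\<^sub>1 \<noteq> a\<^sub>2 \<and> a\<^sub>1 - a\<^sub>2 \<in> cart_power K"
proof (rule ccontr)
  assume neg: "\<not> ?thesis"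
  \<comment> \<open>The roots of \<open>P\<close> are exactly the elements outside \<open>K\<close>;
    thus \<open>0 \<in> K\<close> keeps \<open>poly P 0\<close> non-zero.\<close>
  define P where "P = (\<Prod>k\<in>- K. [:- k, 1:])"
  have P_zero_iff: "poly P x = 0 \<longleftrightarrow> x \<notin> K" for x
    by (simp add: P_def poly_prod)
  have "degree P = card (- K)"
    by (simp add: P_def degree_prod_eq_sum_degree)
  also have "\<dots> = p - t"
    unfolding Compl_eq_Diff_UNIV using assms by (subst card_Diff_subset) simp_all
  finally have "degree P \<le> p - t"
    by simp
  moreover have "poly P 0 \<noteq> 0"
    using P_zero_iff assms by simp
  moreover have "\<exists>i. poly P (b $ i - a $ i) = 0" if "a \<in> A" "b \<in> A" "a \<noteq> b" for a b
  proof -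
    \<comment> \<open>\<open>K\<close> need not be symmetric, so the order matters: \<open>b\<close>
      plays the role of \<open>a\<^sub>1\<close> and \<open>a\<close> that of
      \<open>a\<^sub>2\<close>.\<close>
    have "b - a \<notin> cart_power K"
      using neg that by metis
    then show ?thesis
      by (simp only: cart_power_def P_zero_iff vector_minus_component mem_Collect_eq not_all)
  qed
  ultimately have "card A \<le> (p - t + 1) ^ CARD('n)"
    by (rule card_le_monomials_if_separating_poly)
  then show False
    using assms by simp
qed

end
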